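(* Any online $k$-server algorithm that is $O(1)$-acceptably fair (and hence $O(k)$-competitive) can be transformed into an online $k$-server algorithm that is $O(1)$-multiplicatively fair and has competitive ratio $O(k)$.
   Context: $k$-server problem: $k$ servers in a metric space of diameter $\mathrm{diam}$ serve an online request sequence $\sigma$; after each request some server must be at the requested point; algorithms may additionally move servers arbitrarily, paying the distance traveled. $c_i(A,\sigma)$ is server $i$'s total cost; $\mathrm{cost}(A,\sigma)=\sum_i c_i(A,\sigma)$; $\mathrm{OPT}(\sigma)$ is the optimal offline total cost. $A$ is $c$-competitive if $\mathrm{cost}(A,\sigma)\le c\cdot\mathrm{OPT}(\sigma)+C$ for a constant $C$ and all $\sigma$. $A$ is $\alpha$-multiplicatively fair if $\max_{i,j}c_i(A,\sigma)/c_j(A,\sigma)\le\alpha$ for all $\sigma$; $\gamma$-acceptably fair if $\max_i c_i(A,\sigma)\le\gamma\,\mathrm{OPT}(\sigma)$ for all $\sigma$. $O(1)$, $O(k)$ have constants independent of $k$ and $\sigma$. *)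

theory Defs
  imports "HOL-Analysis.Abstract_Metric_Spaces"
begin

text \<open>The distance covered by a server that visits the listed points in order.\<close>

fun path_length :: "('a \<Rightarrow> 'a \<Rightarrow> real) \<Rightarrow> 'a list \<Rightarrow> real" where
  "path_length d (x # y # xs) = d x y + path_length d (y # xs)"
| "path_length d xs = 0"

text \<open>
  In response to a request every server may visit any finite number of points, for instance make
  a detour and come back, and it pays for the whole way. A schedule therefore assigns to each time
  step and each server the list of points that the server visits during that step (the empty list
  if it stays put). An online algorithm assigns such lists to the requests revealed so far, the
  current one being the last element.
\<close>

type_synonym 'a schedule = "nat \<Rightarrow> nat \<Rightarrow> 'a list"
type_synonym 'a algorithm = "'a list \<Rightarrow> nat \<Rightarrow> 'a list"

definition run :: "'a algorithm \<Rightarrow> 'a list \<Rightarrow> 'a schedule" where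
  "run A \<sigma> = (\<lambda>t i. A (take (Suc t) \<sigma>) i)"

text \<open>The servers are \<open>0, \<dots>, k - 1\<close>, and server \<open>i\<close> starts at the point \<open>s i\<close>.\<close>

locale k_server = Metric_space M d
  for M :: "'a set" and d :: "'a \<Rightarrow> 'a \<Rightarrow> real" +
  fixes k :: nat and s :: "nat \<Rightarrow> 'a"
  assumes k_pos: "k \<ge> 1"
    and finite_diameter: "mbounded M"
    and start_in_space: "\<And>i. i < k \<Longrightarrow> s i \<in> M"
begin

definition route :: "'a schedule \<Rightarrow> nat \<Rightarrow> nat \<Rightarrow> 'a list" where
  "route S n i = s i # concat (map (\<lambda>t. S t i) [0..<n])"

definition position :: "'a schedule \<Rightarrow> nat \<Rightarrow> nat \<Rightarrow> 'a" where
  "position S n i = last (route S n i)"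

definition serves :: "'a schedule \<Rightarrow> 'a list \<Rightarrow> bool" where
  "serves S \<sigma> \<longleftrightarrow>
     (\<forall>t < length \<sigma>. (\<forall>i < k. set (S t i) \<subseteq> M) \<and> (\<exists>i < k. position S (Suc t) i = \<sigma> ! t))"

definition schedule_cost :: "'a schedule \<Rightarrow> nat \<Rightarrow> real" where
  "schedule_cost S n = (\<Sum>i<k. path_length d (route S n i))"

definition OPT :: "'a list \<Rightarrow> real" where
  "OPT \<sigma> = (INF S \<in> {S. serves S \<sigma>}. schedule_cost S (length \<sigma>))"

definition online_algorithm :: "'a algorithm \<Rightarrow> bool" where
  "online_algorithm A \<longleftrightarrow> (\<forall>\<sigma> \<in> lists M. serves (run A \<sigma>) \<sigma>)"

definition server_cost :: "'a algorithm \<Rightarrow> 'a list \<Rightarrow> nat \<Rightarrow> real" where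
  "server_cost A \<sigma> i = path_length d (route (run A \<sigma>) (length \<sigma>) i)"

definition cost :: "'a algorithm \<Rightarrow> 'a list \<Rightarrow> real" where
  "cost A \<sigma> = (\<Sum>i<k. server_cost A \<sigma> i)"

definition competitive :: "real \<Rightarrow> 'a algorithm \<Rightarrow> bool" where
  "competitive c A \<longleftrightarrow> (\<exists>C. \<forall>\<sigma> \<in> lists M. cost A \<sigma> \<le> c * OPT \<sigma> + C)"

text \<open>
  The ratios of server costs are bounded in multiplied-out form. This agrees with the bound on the
  quotient if the denominator is positive; if one server has cost 0 (as on the empty request
  sequence), all servers must have cost 0, whereas HOL's \<open>x / 0 = 0\<close> would impose no constraint.
\<close>

definition multiplicatively_fair :: "real \<Rightarrow> 'a algorithm \<Rightarrow> bool" where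
  "multiplicatively_fair \<alpha> A \<longleftrightarrow>
     (\<forall>\<sigma> \<in> lists M. \<forall>i < k. \<forall>j < k. server_cost A \<sigma> i \<le> \<alpha> * server_cost A \<sigma> j)"

definition acceptably_fair :: "real \<Rightarrow> 'a algorithm \<Rightarrow> bool" where
  "acceptably_fair \<gamma> A \<longleftrightarrow> (\<forall>\<sigma> \<in> lists M. (MAX i\<in>{..<k}. server_cost A \<sigma> i) \<le> \<gamma> * OPT \<sigma>)"

end

end

theory Submission
  imports Defs
begin

text \<open>
  Every server follows the given algorithm and in addition makes round trips from its current
  position to a point whose distance is comparable to the diameter. All servers have made the same
  number of round trips at any time, namely \<open>1 + \<lfloor>m / l\<rfloor>\<close>, where \<open>m\<close> is the
  largest cost that a server incurs in the given algorithm and \<open>l\<close> is a quarter of the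
  diameter. The round trips then dominate the cost of every server, so the costs agree up to a
  constant factor. They cost \<open>O(m + l)\<close> per server, where \<open>m \<le> \<gamma> OPT\<close>, and the term
  proportional to \<open>l\<close> goes into the additive constant.
\<close>

section \<open>Path lengths, and distant points in a bounded metric space\<close>

lemma path_length_append:
  "path_length d ((x # xs) @ ys) = path_length d (x # xs) + path_length d (last (x # xs) # ys)"
  by (induction xs arbitrary: x) auto

lemma path_length_round_trips:
  "path_length d (x # concat (replicate n [y, x])) = real n * (d x y + d y x)"
  by (induction n) (auto simp: algebra_simps)

lemma last_round_trips: "last (xs @ concat (replicate n [y, last xs])) = last xs"
  by (induction n) (auto simp: last_append)

lemma (in Metric_space) path_length_nonneg: "0 \<le> path_length d xs"
  by (induction xs rule: induct_list012) auto

text \<open>Take \<open>l\<close> as a quarter of the diameter. By the triangle inequality no point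
  can be close to both ends of a pair that is more than half the diameter apart.\<close>

lemma (in Metric_space) ex_distant_point:
  assumes "mbounded M" "p \<in> M" "q \<in> M" "p \<noteq> q"
  shows "\<exists>l > 0. \<forall>x \<in> M. \<exists>y \<in> M. l \<le> d x y \<and> d x y \<le> 4 * l"
proof -
  define S where "S = (\<lambda>(x, y). d x y) ` (M \<times> M)"
  obtain B where "\<forall>x \<in> M. \<forall>y \<in> M. d x y \<le> B"
    using assms(1) by (auto simp: mbounded_alt)
  then have bdd: "bdd_above S"
    by (auto simp: S_def intro!: bdd_aboveI[where M = B])
  have "S \<noteq> {}"
    using assms(2) by (auto simp: S_def)
  have upper: "d x y \<le> Sup S" if "x \<in> M" "y \<in> M" for x y
    using that bdd by (intro cSup_upper) (auto simp: S_def)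
  have pos: "0 < Sup S"
    using upper[of p q] nonneg[of p q] zero[of p q] assms by linarith
  then have "Sup S / 2 < Sup S"
    by simp
  \<comment> \<open>The supremum need not be attained, hence a pair beyond half of it.\<close>
  then obtain u v where uv: "u \<in> M" "v \<in> M" "Sup S / 2 < d u v"
    using less_cSupD[OF \<open>S \<noteq> {}\<close>] by (fastforce simp: S_def)
  have "\<exists>y \<in> M. Sup S / 4 \<le> d x y" if "x \<in> M" for x
  proof -
    have "d u v \<le> d x u + d x v"
      using triangle[of u x v] commute[of u x] uv that by simp
    then have "Sup S / 4 \<le> d x u \<or> Sup S / 4 \<le> d x v"
      using uv(3) by linarith
    then show ?thesis
      using uv by blast
  qed
  then show ?thesis
    using pos upper by (intro exI[of _ "Sup S / 4"]) fastforce
qed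

section \<open>Routes when the request sequence grows by one request\<close>

context k_server
begin

definition final_position :: "'a algorithm \<Rightarrow> 'a list \<Rightarrow> nat \<Rightarrow> 'a" where
  "final_position A \<sigma> i = position (run A \<sigma>) (length \<sigma>) i"

text \<open>This is what being online means: a response depends only on the requests revealed so
  far.\<close>

lemma route_run_take:
  assumes "n \<le> length \<sigma>"
  shows "route (run A \<sigma>) n i = route (run A (take n \<sigma>)) n i"
  using assms unfolding route_def run_def
  by (intro arg_cong2[where f = Cons] arg_cong[where f = concat] map_cong)
     (auto simp: min_def)

lemma position_run:
  "n \<le> length \<sigma> \<Longrightarrow> position (run A \<sigma>) n i = final_position A (take n \<sigma>) i"
  unfolding position_def final_position_def by (subst route_run_take) auto

lemma route_run_snoc:
  "route (run A (\<sigma> @ [r])) (Suc (length \<sigma>)) i =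
     route (run A \<sigma>) (length \<sigma>) i @ A (\<sigma> @ [r]) i"
proof -
  have "route (run A (\<sigma> @ [r])) (Suc (length \<sigma>)) i =
      route (run A (\<sigma> @ [r])) (length \<sigma>) i @ A (\<sigma> @ [r]) i"
    by (simp add: route_def run_def)
  then show ?thesis
    by (subst (asm) (2) route_run_take) auto
qed

lemma final_position_Nil [simp]: "final_position A [] i = s i"
  by (simp add: final_position_def position_def route_def)

lemma final_position_snoc:
  "final_position A (\<sigma> @ [r]) i = last (final_position A \<sigma> i # A (\<sigma> @ [r]) i)"
  by (simp add: final_position_def position_def route_run_snoc)

lemma server_cost_Nil [simp]: "server_cost A [] i = 0"
  by (simp add: server_cost_def route_def)

lemma server_cost_snoc:
  "server_cost A (\<sigma> @ [r]) i =
     server_cost A \<sigma> i + path_length d (final_position A \<sigma> i # A (\<sigma> @ [r]) i)"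
proof -
  obtain xs where "route (run A \<sigma>) (length \<sigma>) i = s i # xs"
    by (simp add: route_def)
  then show ?thesis
    using path_length_append[of d "s i" xs "A (\<sigma> @ [r]) i"]
    by (simp add: server_cost_def final_position_def position_def route_run_snoc)
qed

lemma server_cost_snoc_ge: "server_cost A \<sigma> i \<le> server_cost A (\<sigma> @ [r]) i"
  using path_length_nonneg by (simp add: server_cost_snoc)

lemma server_cost_nonneg: "0 \<le> server_cost A \<sigma> i"
  using path_length_nonneg by (simp add: server_cost_def)

text \<open>Prefixes of lists over \<open>M\<close> are again lists over \<open>M\<close>, so the
  conditions at all time steps reduce to the condition at the last step of each sequence. Inductions
  over appended requests can use this form directly.\<close>

lemma online_algorithm_iff:
  "online_algorithm A \<longleftrightarrow>
     (\<forall>\<sigma> r. \<sigma> \<in> lists M \<longrightarrow> r \<in> M \<longrightarrow>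
        (\<forall>i < k. set (A (\<sigma> @ [r]) i) \<subseteq> M) \<and> (\<exists>i < k. final_position A (\<sigma> @ [r]) i = r))"
  (is "_ \<longleftrightarrow> ?R")
proof
  assume A: "online_algorithm A"
  show ?R
  proof (intro allI impI)
    fix \<sigma> r
    assume "\<sigma> \<in> lists M" "r \<in> M"
    then have "serves (run A (\<sigma> @ [r])) (\<sigma> @ [r])"
      using A by (simp add: online_algorithm_def)
    then show "(\<forall>i < k. set (A (\<sigma> @ [r]) i) \<subseteq> M) \<and>
        (\<exists>i < k. final_position A (\<sigma> @ [r]) i = r)"
      unfolding serves_def
      by (elim allE[of _ "length \<sigma>"]) (simp add: run_def final_position_def)
  qed
next
  assume R: ?R
  show "online_algorithm A"
    unfolding online_algorithm_def serves_def
  proof (intro ballI allI impI)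
    fix \<sigma> t
    assume \<sigma>: "\<sigma> \<in> lists M" and t: "t < length \<sigma>"
    have "take t \<sigma> \<in> lists M" "\<sigma> ! t \<in> M"
      using \<sigma> t by (auto dest: in_set_takeD)
    moreover have "run A \<sigma> t = A (take t \<sigma> @ [\<sigma> ! t])"
      using t by (simp add: run_def take_Suc_conv_app_nth)
    ultimately show "(\<forall>i < k. set (run A \<sigma> t i) \<subseteq> M) \<and>
        (\<exists>i < k. position (run A \<sigma>) (Suc t) i = \<sigma> ! t)"
      using R t by (simp add: position_run take_Suc_conv_app_nth)
  qed
qed

lemma final_position_in_space:
  assumes "online_algorithm A" "\<sigma> \<in> lists M" "i < k"
  shows "final_position A \<sigma> i \<in> M"
  using assms(2)
proof (induction \<sigma> rule: rev_induct)
  case Nil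
  then show ?case
    using start_in_space assms(3) by simp
next
  case (snoc r \<sigma>)
  then have "final_position A \<sigma> i \<in> M" "set (A (\<sigma> @ [r]) i) \<subseteq> M"
    using assms by (auto simp: online_algorithm_iff)
  then show ?case
    by (auto simp: final_position_snoc)
qed

section \<open>Adding round trips to an algorithm\<close>

text \<open>\<open>N\<close> prescribes the cumulative number of round trips, so each step makes up
  the difference to the previous prefix. The trips start where \<open>A\<close> leaves the server,
  which is also the position of the new algorithm because every trip returns to its start.\<close>

definition add_round_trips ::
  "('a \<Rightarrow> 'a) \<Rightarrow> ('a list \<Rightarrow> nat) \<Rightarrow> 'a algorithm \<Rightarrow> 'a algorithm" where
  "add_round_trips f N A = (\<lambda>\<sigma> i. A \<sigma> i @
     concat (replicate (N \<sigma> - N (butlast \<sigma>)) [f (final_position A \<sigma> i), final_position A \<sigma> i]))"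

lemma final_position_add_round_trips [simp]:
  "final_position (add_round_trips f N A) \<sigma> i = final_position A \<sigma> i"
proof (induction \<sigma> rule: rev_induct)
  case Nil
  then show ?case by simp
next
  case (snoc r \<sigma>)
  then show ?case
    using last_round_trips[of "final_position A \<sigma> i # A (\<sigma> @ [r]) i"]
    by (simp only: final_position_snoc add_round_trips_def append_Cons)
qed

lemma online_algorithm_add_round_trips:
  assumes A: "online_algorithm A" and f: "f \<in> M \<rightarrow> M"
  shows "online_algorithm (add_round_trips f N A)"
  unfolding online_algorithm_iff
proof (intro allI impI conjI)
  fix \<sigma> r i
  assume \<sigma>: "\<sigma> \<in> lists M" "r \<in> M" and i: "i < k"
  have "final_position A (\<sigma> @ [r]) i \<in> M"
    using final_position_in_space[OF A] \<sigma> i by simp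
  moreover have "set (A (\<sigma> @ [r]) i) \<subseteq> M"
    using A \<sigma> i by (auto simp: online_algorithm_iff)
  ultimately show "set (add_round_trips f N A (\<sigma> @ [r]) i) \<subseteq> M"
    using f by (auto simp: add_round_trips_def)
next
  fix \<sigma> r
  assume "\<sigma> \<in> lists M" "r \<in> M"
  then show "\<exists>i < k. final_position (add_round_trips f N A) (\<sigma> @ [r]) i = r"
    using A by (simp add: online_algorithm_iff)
qed

text \<open>Both algorithms start the step at the same point and first make the moves of
  \<open>A\<close>; each trip then pays the distance to \<open>f\<close> twice, by symmetry of
  \<open>d\<close>.\<close>

lemma server_cost_add_round_trips_snoc:
  "server_cost (add_round_trips f N A) (\<sigma> @ [r]) i - server_cost (add_round_trips f N A) \<sigma> i =
     server_cost A (\<sigma> @ [r]) i - server_cost A \<sigma> i +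
     real (N (\<sigma> @ [r]) - N \<sigma>) *
       (2 * d (final_position A (\<sigma> @ [r]) i) (f (final_position A (\<sigma> @ [r]) i)))"
  unfolding server_cost_snoc final_position_add_round_trips
  unfolding add_round_trips_def append_Cons[symmetric] path_length_append
    final_position_snoc[symmetric] path_length_round_trips
  using commute by simp

lemma server_cost_add_round_trips_bounds:
  assumes A: "online_algorithm A" and f: "\<And>x. x \<in> M \<Longrightarrow> l \<le> d x (f x) \<and> d x (f x) \<le> u"
    and N: "N [] = 0" "\<And>\<sigma> r. N \<sigma> \<le> N (\<sigma> @ [r])"
    and "\<sigma> \<in> lists M" "i < k"
  shows "server_cost A \<sigma> i + 2 * l * real (N \<sigma>) \<le> server_cost (add_round_trips f N A) \<sigma> i \<and>
         server_cost (add_round_trips f N A) \<sigma> i \<le> server_cost A \<sigma> i + 2 * u * real (N \<sigma>)"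
  using \<open>\<sigma> \<in> lists M\<close>
proof (induction \<sigma> rule: rev_induct)
  case Nil
  then show ?case by (simp add: N)
next
  case (snoc r \<sigma>)
  define \<delta> where
    "\<delta> = d (final_position A (\<sigma> @ [r]) i) (f (final_position A (\<sigma> @ [r]) i))"
  define n where "n = real (N (\<sigma> @ [r]) - N \<sigma>)"
  have "final_position A (\<sigma> @ [r]) i \<in> M"
    using final_position_in_space[OF A] snoc.prems \<open>i < k\<close> by blast
  then have "l \<le> \<delta>" "\<delta> \<le> u"
    using f by (auto simp: \<delta>_def)
  then have "l * n \<le> \<delta> * n" "\<delta> * n \<le> u * n"
    by (auto simp: n_def mult_right_mono)
  \<comment> \<open>Monotonicity of \<open>N\<close> makes the truncated subtraction exact, so the
    increments telescope.\<close>
  moreover have "real (N (\<sigma> @ [r])) = real (N \<sigma>) + n"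
    using N(2)[of \<sigma> r] by (simp add: n_def)
  ultimately show ?case
    using snoc server_cost_add_round_trips_snoc[of f N A \<sigma> r i, folded \<delta>_def n_def]
    by (simp add: algebra_simps)
qed

section \<open>The largest server cost and the competitive ratio\<close>

lemma server_cost_le_Max: "i < k \<Longrightarrow> server_cost A \<sigma> i \<le> (MAX i\<in>{..<k}. server_cost A \<sigma> i)"
  by (intro Max_ge) auto

lemma Max_server_cost_snoc_ge:
  "(MAX i\<in>{..<k}. server_cost A \<sigma> i) \<le> (MAX i\<in>{..<k}. server_cost A (\<sigma> @ [r]) i)"
proof -
  have "server_cost A \<sigma> i \<le> (MAX i\<in>{..<k}. server_cost A (\<sigma> @ [r]) i)" if "i < k" for i
    using server_cost_snoc_ge[of A \<sigma> i r] server_cost_le_Max[OF that, of A "\<sigma> @ [r]"] by linarith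
  then show ?thesis
    using k_pos by (auto intro!: Max.boundedI simp: lessThan_empty_iff)
qed

lemma Max_server_cost_nonneg: "0 \<le> (MAX i\<in>{..<k}. server_cost A \<sigma> i)"
  using server_cost_nonneg[of A \<sigma> 0] server_cost_le_Max[of 0 A \<sigma>] k_pos by linarith

lemma cost_le:
  assumes "\<And>i. i < k \<Longrightarrow> server_cost A \<sigma> i \<le> b"
  shows "cost A \<sigma> \<le> real k * b"
  using sum_bounded_above[of "{..<k}" "server_cost A \<sigma>" b] assms by (simp add: cost_def)

text \<open>Each of the \<open>k\<close> summands of the cost is at most \<gamma> times
  \<open>OPT\<close>; the additive constant is 0.\<close>

lemma acceptably_fair_imp_competitive:
  assumes "acceptably_fair \<gamma> A"
  shows "competitive (\<gamma> * real k) A"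
  unfolding competitive_def
proof (intro exI ballI)
  fix \<sigma>
  assume "\<sigma> \<in> lists M"
  then have "server_cost A \<sigma> i \<le> \<gamma> * OPT \<sigma>" if "i < k" for i
    using assms server_cost_le_Max[OF that, of A \<sigma>] by (force simp: acceptably_fair_def)
  then show "cost A \<sigma> \<le> \<gamma> * real k * OPT \<sigma> + 0"
    using cost_le[of A \<sigma> "\<gamma> * OPT \<sigma>"] by (simp add: mult_ac)
qed

text \<open>A one-point space has no round trips of positive length; there \<open>A\<close> itself
  is the fair algorithm, since nothing ever costs anything.\<close>

lemma server_cost_singleton:
  assumes A: "online_algorithm A" and M: "M = {p}" and "\<sigma> \<in> lists M" "i < k"
  shows "server_cost A \<sigma> i = 0"
  using \<open>\<sigma> \<in> lists M\<close>
proof (induction \<sigma> rule: rev_induct)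
  case Nil
  then show ?case by simp
next
  case (snoc r \<sigma>)
  have zero: "path_length d xs = 0" if "set xs \<subseteq> M" for xs
    using that M by (induction xs rule: induct_list012) auto
  have "path_length d (final_position A \<sigma> i # A (\<sigma> @ [r]) i) = 0"
    using A snoc.prems \<open>i < k\<close> final_position_in_space[OF A]
    by (intro zero) (auto simp: online_algorithm_iff)
  then show ?case
    using snoc by (simp add: server_cost_snoc)
qed

text \<open>With \<open>l * N\<close> at least every server cost of \<open>A\<close>, the new server
  costs lie between \<open>2 * l * N\<close> and \<open>9 * l * N\<close>, which gives the ratio
  9/2. Since \<open>l * N\<close> is at most \<open>l + m\<close>, the competitive ratio
  follows.\<close>

lemma ex_multiplicatively_fair_competitive:
  assumes A: "online_algorithm A" and fair: "acceptably_fair \<gamma> A"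
  shows "\<exists>A'. online_algorithm A' \<and> multiplicatively_fair (9 / 2) A' \<and>
    competitive (9 * \<gamma> * real k) A'"
proof (cases "\<exists>p. M = {p}")
  case True
  then have cost: "server_cost A \<sigma> i = 0" if "\<sigma> \<in> lists M" "i < k" for \<sigma> i
    using server_cost_singleton[OF A] that by blast
  have "(MAX i\<in>{..<k}. server_cost A \<sigma> i) = 0" if "\<sigma> \<in> lists M" for \<sigma>
    using that cost k_pos Max_server_cost_nonneg[of A \<sigma>]
    by (intro antisym) (auto intro!: Max.boundedI simp: lessThan_empty_iff)
  \<comment> \<open>The hypothesis now says that \<gamma> times \<open>OPT\<close> is nonnegative,
    so the factor 9 is harmless whatever the sign of \<gamma>.\<close>
  then have "acceptably_fair (9 * \<gamma>) A"
    using fair by (simp add: acceptably_fair_def)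
  moreover have "multiplicatively_fair (9 / 2) A"
    using cost by (simp add: multiplicatively_fair_def)
  ultimately show ?thesis
    using A acceptably_fair_imp_competitive by blast
next
  case False
  then obtain p q where "p \<in> M" "q \<in> M" "p \<noteq> q"
    using start_in_space[of 0] k_pos by (metis One_nat_def Suc_le_lessD singleton_iff subsetI subset_antisym)
  then obtain l f where l: "l > 0" and f: "\<And>x. x \<in> M \<Longrightarrow> f x \<in> M \<and> l \<le> d x (f x) \<and> d x (f x) \<le> 4 * l"
    using ex_distant_point[OF finite_diameter] by metis
  define m where "m = (\<lambda>\<sigma>. MAX i\<in>{..<k}. server_cost A \<sigma> i)"
  \<comment> \<open>The successor compensates for rounding down, so that \<open>l * N\<close>
    reaches \<open>m\<close>. The empty sequence triggers no response, so its count must be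
    0.\<close>
  define N where "N = (\<lambda>\<sigma> :: 'a list. if \<sigma> = [] then 0 else Suc (nat \<lfloor>m \<sigma> / l\<rfloor>))"
  define A' where "A' = add_round_trips f N A"
  have "N \<sigma> \<le> N (\<sigma> @ [r])" for \<sigma> r
    using Max_server_cost_snoc_ge[of A \<sigma> r] l
    by (simp add: N_def m_def nat_mono floor_mono divide_right_mono)
  then have bounds: "server_cost A \<sigma> i + 2 * l * real (N \<sigma>) \<le> server_cost A' \<sigma> i"
      "server_cost A' \<sigma> i \<le> server_cost A \<sigma> i + 8 * l * real (N \<sigma>)"
    if "\<sigma> \<in> lists M" "i < k" for \<sigma> i
    using server_cost_add_round_trips_bounds[OF A, of l f "4 * l" N] f that
    by (auto simp: A'_def N_def)
  have cost_le_N: "server_cost A \<sigma> i \<le> l * real (N \<sigma>)" if "i < k" for \<sigma> i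
  proof (cases "\<sigma> = []")
    case False
    have "m \<sigma> / l \<le> real (N \<sigma>)"
      using False by (simp add: N_def) linarith
    then show ?thesis
      using server_cost_le_Max[OF that, of A \<sigma>] l by (simp add: m_def field_simps)
  qed (simp add: N_def)
  have N_le: "l * real (N \<sigma>) \<le> l + m \<sigma>" for \<sigma>
  proof -
    have "0 \<le> m \<sigma>"
      using Max_server_cost_nonneg by (simp add: m_def)
    then have "real (N \<sigma>) \<le> 1 + m \<sigma> / l"
      using l by (auto simp: N_def)
    then show ?thesis
      using l by (simp add: field_simps)
  qed
  have "server_cost A' \<sigma> i \<le> 9 / 2 * server_cost A' \<sigma> j"
    if "\<sigma> \<in> lists M" "i < k" "j < k" for \<sigma> i j
    using bounds[OF that(1,2)] bounds[OF that(1,3)] cost_le_N[OF that(2), of \<sigma>]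
      server_cost_nonneg[of A \<sigma> j] by linarith
  then have "multiplicatively_fair (9 / 2) A'"
    by (simp add: multiplicatively_fair_def)
  moreover have "competitive (9 * \<gamma> * real k) A'"
    unfolding competitive_def
  proof (intro exI ballI)
    fix \<sigma>
    assume \<sigma>: "\<sigma> \<in> lists M"
    then have "m \<sigma> \<le> \<gamma> * OPT \<sigma>"
      using fair by (simp add: acceptably_fair_def m_def)
    \<comment> \<open>One share of \<open>l * N\<close> covers the moves of \<open>A\<close> and
      eight cover the round trips of length at most \<open>8 * l\<close>.\<close>
    then have "server_cost A' \<sigma> i \<le> 9 * (l + \<gamma> * OPT \<sigma>)" if "i < k" for i
      using bounds(2)[OF \<sigma> that] cost_le_N[OF that, of \<sigma>] N_le[of \<sigma>] by (simp add: algebra_simps)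
    then show "cost A' \<sigma> \<le> 9 * \<gamma> * real k * OPT \<sigma> + 9 * real k * l"
      using cost_le[of A' \<sigma> "9 * (l + \<gamma> * OPT \<sigma>)"] by (simp add: algebra_simps)
  qed
  moreover have "online_algorithm A'"
    using online_algorithm_add_round_trips[OF A, of f N] f by (auto simp: A'_def)
  ultimately show ?thesis
    by blast
qed

end

theorem theorem17:
  fixes \<gamma> :: real
  shows "\<exists>b \<alpha> c :: real. \<forall>(M :: 'a set) d k s A.
    k_server M d k s \<longrightarrow>
    k_server.online_algorithm M k s A \<longrightarrow>
    k_server.acceptably_fair M d k s \<gamma> A \<longrightarrow>
      k_server.competitive M d k s (b * real k) A \<and>
      (\<exists>A'. k_server.online_algorithm M k s A' \<and>
            k_server.multiplicatively_fair M d k s \<alpha> A' \<and>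
            k_server.competitive M d k s (c * real k) A')"
  using k_server.acceptably_fair_imp_competitive k_server.ex_multiplicatively_fair_competitive
  \<comment> \<open>All three constants depend on \<gamma> alone, so they can be fixed before the
    space, \<open>k\<close> and \<open>A\<close>.\<close>
  by (intro exI[of _ \<gamma>] exI[of _ "9 / 2"] exI[of _ "9 * \<gamma>"]) blast

end
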